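(* Consider the problem of maximizing $f(\mathbf z)=\sum_{1\le j<k\le n}\log(|z_k-z_j|^2)$ over $\mathbf z=(z_1,\dots,z_n)\in\mathbb C^n$ subject to $g_{j,k}(\mathbf z)=|z_k-z_j|^2-4\le 0$ for all $1\le j<k\le n$. For any local maximizer $\mathbf z$ of this problem there exist real numbers $\lambda_{j,k}\ge 0$ ($1\le j<k\le n$) such that $\lambda_{j,k}\,g_{j,k}(\mathbf z)=0$ for all $1\le j<k\le n$, and for every $k\in\{1,\dots,n\}$, \[ \sum_{j\neq k}\frac{1}{z_j-z_k}=\sum_{j<k}\lambda_{j,k}\,(\overline{z_j}-\overline{z_k})+\sum_{j>k}\lambda_{k,j}\,(\overline{z_j}-\overline{z_k}). \]
   Context: Here $\log 0=-\infty$, and $\overline{z}$ denotes complex conjugation. *)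

theory Defs
  imports "HOL-Analysis.Analysis"
begin

text \<open>
  The index set $\{1, \dots, n\}$ is a finite linearly ordered type \<open>'n\<close>, so that $\mathbb{C}^n$
  is \<open>complex ^ 'n\<close>. Every $n \geq 1$ occurs, for instance through the numeral types.
\<close>

text \<open>The library's \<open>ln\<close> is real-valued at \<open>0\<close>; here $\log 0 = -\infty$. Only used on \<open>x \<ge> 0\<close>.\<close>
definition elog :: "real \<Rightarrow> ereal" where
  "elog x = (if x = 0 then -\<infinity> else ereal (ln x))"

definition objective :: "complex ^ 'n::{finite, linorder} \<Rightarrow> ereal" where
  "objective z = (\<Sum>(j, k) \<in> {(j, k). j < k}. elog ((cmod (z $ k - z $ j))\<^sup>2))"

definition constraint :: "'n \<Rightarrow> 'n \<Rightarrow> complex ^ 'n::{finite, linorder} \<Rightarrow> real" where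
  "constraint j k z = (cmod (z $ k - z $ j))\<^sup>2 - 4"

definition feasible :: "(complex ^ 'n::{finite, linorder}) set" where
  "feasible = {z. \<forall>j k. j < k \<longrightarrow> constraint j k z \<le> 0}"

definition local_maximizer :: "('a::topological_space \<Rightarrow> 'b::order) \<Rightarrow> 'a set \<Rightarrow> 'a \<Rightarrow> bool" where
  "local_maximizer f S z \<longleftrightarrow> z \<in> S \<and> (\<forall>\<^sub>F w in at z within S. f w \<le> f z)"

end

theory Submission
  imports Defs
begin

text \<open>
  A local maximizer \<open>z\<close> has distinct coordinates, since moving it slightly towards an interior
  feasible point with distinct coordinates would raise the objective above \<open>-\<infinity>\<close>. A direction
  increasing the objective to first order cannot strictly decrease all active constraints, so
  separation puts \<open>0\<close> into the convex hull of the negated gradient of the objective and the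
  gradients of the active constraints (Fritz John). The coefficient of the objective does not
  vanish: the inner product of \<open>z\<close> with the gradient of \<open>\<bar>z\<^sub>k - z\<^sub>j\<bar>\<^sup>2\<close> is \<open>2 \<bar>z\<^sub>k - z\<^sub>j\<bar>\<^sup>2\<close>, which is
  positive on active constraints.
\<close>

section \<open>Convex hulls and the Fritz John alternative\<close>

lemma convex_hull_image_sum:
  fixes f :: "'i \<Rightarrow> 'a::real_vector"
  assumes "finite I" "x \<in> convex hull (f ` I)"
  obtains u where "\<forall>i\<in>I. u i \<ge> (0::real)" "sum u I = 1" "(\<Sum>i\<in>I. u i *\<^sub>R f i) = x"
proof -
  \<comment> \<open>\<open>f\<close> may repeat values: \<open>J\<close> keeps one index for each
    value, and the other indices get weight 0.\<close>
  obtain J where J: "J \<subseteq> I" "inj_on f J" "f ` I = f ` J"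
    using subset_image_inj[of "f ` I" f I] by auto
  have finJ: "finite J" using J(1) assms(1) by (rule finite_subset)
  have "x \<in> convex hull (f ` J)" using assms(2) J(3) by simp
  then obtain v where v: "\<forall>y\<in>f ` J. 0 \<le> v y" "sum v (f ` J) = 1"
      "(\<Sum>y\<in>f ` J. v y *\<^sub>R y) = x"
    unfolding convex_hull_finite[OF finite_imageI[OF finJ]] by auto
  define u where "u i = (if i \<in> J then v (f i) else 0)" for i
  show thesis
  proof
    show "\<forall>i\<in>I. u i \<ge> 0" using v(1) by (auto simp: u_def)
    have "sum u I = sum u J"
      using assms(1) J(1) by (intro sum.mono_neutral_right) (auto simp: u_def)
    also have "\<dots> = sum v (f ` J)" by (simp add: sum.reindex[OF J(2)] u_def)
    finally show "sum u I = 1" using v(2) by simp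
    have "(\<Sum>i\<in>I. u i *\<^sub>R f i) = (\<Sum>i\<in>J. u i *\<^sub>R f i)"
      using assms(1) J(1) by (intro sum.mono_neutral_right) (auto simp: u_def)
    also have "\<dots> = (\<Sum>y\<in>f ` J. v y *\<^sub>R y)" by (simp add: sum.reindex[OF J(2)] u_def)
    finally show "(\<Sum>i\<in>I. u i *\<^sub>R f i) = x" using v(3) by simp
  qed
qed

text \<open>If 0 were outside the convex hull of \<open>- g\<close> and the \<open>f i\<close>, some
  \<open>a\<close> would have positive inner product with all of them. Then \<open>- a\<close> would
  be an ascent direction for \<open>g\<close> along which every \<open>f i\<close> is negative,
  against \<open>no_dir\<close>.\<close>

lemma Fritz_John_alternative:
  fixes g :: "'a::euclidean_space" and f :: "'i \<Rightarrow> 'a"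
  assumes "finite I" and no_dir: "\<And>d. g \<bullet> d > 0 \<Longrightarrow> \<exists>i\<in>I. f i \<bullet> d \<ge> 0"
  obtains \<mu> u where "\<mu> \<ge> (0::real)" "\<forall>i\<in>I. u i \<ge> (0::real)" "\<mu> + sum u I = 1"
    "\<mu> *\<^sub>R g = (\<Sum>i\<in>I. u i *\<^sub>R f i)"
proof -
  \<comment> \<open>The index \<open>None\<close> gives \<open>- g\<close> a weight of its own, even
    if it equals some \<open>f i\<close>.\<close>
  define h where "h = case_option (- g) f"
  define K where "K = insert None (Some ` I)"
  have finK: "finite K" using assms(1) by (simp add: K_def)
  have zero: "0 \<in> convex hull (h ` K)"
  proof (rule ccontr)
    assume n: "0 \<notin> convex hull (h ` K)"
    have cl: "closed (convex hull (h ` K))"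
      using finK by (intro compact_imp_closed compact_convex_hull finite_imp_compact) simp
    obtain a b where ab: "0 < b" "\<And>x. x \<in> convex hull (h ` K) \<Longrightarrow> a \<bullet> x > b"
      using separating_hyperplane_closed_0[OF convex_convex_hull cl n] by blast
    have pos: "a \<bullet> h k > 0" if "k \<in> K" for k
    proof -
      have "h k \<in> convex hull (h ` K)" using that by (intro hull_inc imageI)
      then show ?thesis using ab by fastforce
    qed
    have "g \<bullet> (- a) > 0" using pos[of None] by (simp add: K_def h_def inner_commute)
    then obtain i where "i \<in> I" "f i \<bullet> (- a) \<ge> 0" using no_dir by blast
    with pos[of "Some i"] show False by (simp add: K_def h_def inner_commute)
  qed
  obtain w where
    w: "\<forall>k\<in>K. w k \<ge> (0::real)" "sum w K = 1" "(\<Sum>k\<in>K. w k *\<^sub>R h k) = 0"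
    by (rule convex_hull_image_sum[OF finK zero])
  have split: "sum p K = p None + (\<Sum>i\<in>I. p (Some i))" for p :: "'i option \<Rightarrow> 'b::comm_monoid_add"
    using assms(1) by (simp add: K_def sum.reindex image_iff)
  show thesis
  proof
    show "w None \<ge> 0" "\<forall>i\<in>I. w (Some i) \<ge> 0" using w(1) by (auto simp: K_def)
    show "w None + (\<Sum>i\<in>I. w (Some i)) = 1" using w(2) by (simp add: split)
    show "w None *\<^sub>R g = (\<Sum>i\<in>I. w (Some i) *\<^sub>R f i)" using w(3) by (simp add: split h_def)
  qed
qed

section \<open>Finiteness of the objective and distinct coordinates\<close>

lemma local_maximizer_eventually_le:
  assumes "local_maximizer f S z" "(g \<longlongrightarrow> z) F" "\<forall>\<^sub>F t in F. g t \<in> S"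
  shows "\<forall>\<^sub>F t in F. f (g t) \<le> f z"
proof -
  \<comment> \<open>The filter in \<open>local_maximizer\<close> leaves out \<open>z\<close>. There
    the inequality is trivial, so \<open>g\<close> may return to \<open>z\<close>.\<close>
  have "\<forall>\<^sub>F w in nhds z. w \<noteq> z \<longrightarrow> w \<in> S \<longrightarrow> f w \<le> f z"
    using assms(1) by (simp add: local_maximizer_def eventually_at_filter)
  then have "\<forall>\<^sub>F t in F. g t \<noteq> z \<longrightarrow> g t \<in> S \<longrightarrow> f (g t) \<le> f z"
    using assms(2) by (rule eventually_compose_filterlim)
  with assms(3) show ?thesis by eventually_elim auto
qed

lemma feasible_iff: "z \<in> feasible \<longleftrightarrow> (\<forall>j k. j < k \<longrightarrow> cmod (z $ k - z $ j) \<le> 2)"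
proof -
  have "x\<^sup>2 - 4 \<le> 0 \<longleftrightarrow> x \<le> 2" if "x \<ge> 0" for x :: real
    using abs_le_square_iff[of x 2] that by simp
  then show ?thesis by (simp add: feasible_def constraint_def)
qed

lemma objective_inj:
  assumes "inj (($) z)"
  shows "objective z = ereal (\<Sum>(j, k) \<in> {(j, k). j < k}. ln ((cmod (z $ k - z $ j))\<^sup>2))"
proof -
  have "elog ((cmod (z $ k - z $ j))\<^sup>2) = ereal (ln ((cmod (z $ k - z $ j))\<^sup>2))" if "j < k" for j k
    using that injD[OF assms, of k j] by (auto simp: elog_def)
  then show ?thesis
    unfolding objective_def sum_ereal[symmetric] by (intro sum.cong) auto
qed

lemma objective_not_inj:
  fixes z :: "complex ^ 'n::{finite, linorder}"
  assumes "\<not> inj (($) z)"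
  shows "objective z = -\<infinity>"
proof -
  obtain j k where jk: "j < k" "z $ j = z $ k"
    using assms by (metis injI linorder_neqE)
  let ?P = "{(j, k). j < (k::'n)}"
  let ?r = "\<Sum>(j, k) \<in> ?P - {(j, k)}. elog ((cmod (z $ k - z $ j))\<^sup>2)"
  have "objective z = elog 0 + ?r"
    unfolding objective_def using jk by (subst sum.remove[of ?P "(j, k)"]) auto
  \<comment> \<open>This must be excluded because in \<open>ereal\<close> the sum of -\<infinity>
    and \<infinity> is \<infinity>.\<close>
  moreover have "?r \<noteq> \<infinity>"
    by (auto simp: sum_Pinfty elog_def split: if_splits)
  ultimately show ?thesis by (cases ?r) (auto simp: elog_def)
qed

lemma eventually_inj_vec:
  fixes w :: "real \<Rightarrow> complex ^ 'n::{finite, linorder}"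
  assumes "\<And>j k. j < k \<Longrightarrow> \<forall>\<^sub>F t in F. w t $ k - w t $ j \<noteq> 0"
  shows "\<forall>\<^sub>F t in F. inj (($) (w t))"
proof -
  have "\<forall>\<^sub>F t in F. \<forall>j k. j < k \<longrightarrow> w t $ k - w t $ j \<noteq> 0"
    using assms by (intro eventually_all_finite) (auto simp: eventually_mono)
  then show ?thesis
    by eventually_elim (rule injI, metis linorder_neqE right_minus_eq)
qed

lemma local_maximizer_inj:
  fixes z :: "complex ^ 'n::{finite, linorder}"
  assumes lm: "local_maximizer objective feasible z"
  shows "inj (($) z)"
proof (rule ccontr)
  assume not_inj: "\<not> inj (($) z)"
  obtain h :: "'n \<Rightarrow> nat" where h: "inj h"
    using finite_imp_inj_to_nat_seg[of "UNIV :: 'n set"] by auto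
  \<comment> \<open>The entries are distinct reals in (0, 1], so \<open>u\<close> is feasible with
    slack. Feasibility of the segment from \<open>z\<close> to \<open>u\<close> is then convexity of
    the norm.\<close>
  define u :: "(complex, 'n) vec" where "u = (\<chi> k. of_real (inverse (real (Suc (h k)))))"
  have u_le: "cmod (u $ k - u $ j) \<le> 2" for j k
  proof -
    have "cmod (u $ i) \<le> 1" for i
      by (simp add: u_def norm_inverse del: of_nat_Suc of_real_inverse) (simp add: field_simps)
    from this[of k] this[of j] show ?thesis using norm_triangle_ineq4[of "u $ k" "u $ j"] by linarith
  qed
  have u_neq: "u $ k \<noteq> u $ j" if "j < k" for j k
    using that injD[OF h, of k j] by (auto simp: u_def simp del: of_nat_Suc)
  define w where "w t = (1 - t) *\<^sub>R z + t *\<^sub>R u" for t :: real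
  have lim: "(w \<longlongrightarrow> z) (at_right 0)"
    unfolding w_def by (auto intro!: tendsto_eq_intros)
  have z_le: "cmod (z $ k - z $ j) \<le> 2" if "j < k" for j k
    using lm that by (auto simp: local_maximizer_def feasible_iff)
  have w_diff: "w t $ k - w t $ j = (1 - t) *\<^sub>R (z $ k - z $ j) + t *\<^sub>R (u $ k - u $ j)" for t j k
    by (simp add: w_def algebra_simps)
  have t01: "\<forall>\<^sub>F t in at_right 0. 0 < t \<and> t < (1::real)"
    using eventually_at_right_real[of 0 1] by simp
  have "\<forall>\<^sub>F t in at_right 0. w t \<in> feasible"
    using t01
  proof eventually_elim
    case (elim t)
    show ?case unfolding feasible_iff
    proof (intro allI impI)
      fix j k :: 'n assume "j < k"
      have "cmod (w t $ k - w t $ j) \<le> (1 - t) * cmod (z $ k - z $ j) + t * cmod (u $ k - u $ j)"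
        unfolding w_diff using elim by (intro norm_triangle_le) simp
      also have "\<dots> \<le> (1 - t) * 2 + t * 2"
        using elim z_le[OF \<open>j < k\<close>] u_le by (intro add_mono mult_left_mono) auto
      finally show "cmod (w t $ k - w t $ j) \<le> 2" by simp
    qed
  qed
  from local_maximizer_eventually_le[OF lm lim this]
  have le: "\<forall>\<^sub>F t in at_right 0. objective (w t) \<le> objective z" .
  have "\<forall>\<^sub>F t in at_right 0. inj (($) (w t))"
  proof (rule eventually_inj_vec)
    fix j k :: 'n assume "j < k"
    show "\<forall>\<^sub>F t in at_right 0. w t $ k - w t $ j \<noteq> 0"
    \<comment> \<open>Coinciding entries of \<open>z\<close> are separated by the summand
      \<open>t *\<^sub>R (u $ k - u $ j)\<close>; distinct ones stay distinct by continuity.\<close>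
    proof (cases "z $ k = z $ j")
      case True
      then show ?thesis using t01 u_neq[OF \<open>j < k\<close>]
        unfolding w_diff by (auto elim!: eventually_mono)
    next
      case False
      have "((\<lambda>t. w t $ k - w t $ j) \<longlongrightarrow> z $ k - z $ j) (at_right 0)"
        by (intro tendsto_intros lim)
      then show ?thesis using False by (intro tendsto_imp_eventually_ne) auto
    qed
  qed
  with le have "\<forall>\<^sub>F t in at_right (0::real). False"
    by eventually_elim (simp add: objective_inj objective_not_inj[OF not_inj])
  then show False by simp
qed

section \<open>First-order analysis along lines\<close>

lemma DERIV_norm_square_line:
  fixes a b :: "'a::real_inner"
  shows "((\<lambda>t. (norm (a + t *\<^sub>R b))\<^sup>2) has_real_derivative 2 * (a \<bullet> b)) (at 0)"
proof -
  have "(norm (a + t *\<^sub>R b))\<^sup>2 = a \<bullet> a + 2 * t * (a \<bullet> b) + t\<^sup>2 * (b \<bullet> b)" for t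
    unfolding power2_norm_eq_inner
    by (simp add: algebra_simps inner_commute power2_eq_square)
  then show ?thesis by (auto intro!: derivative_eq_intros)
qed

text \<open>Half the gradient of \<open>\<bar>z\<^sub>k - z\<^sub>j\<bar>\<^sup>2\<close>, for the real inner product.\<close>
definition pair_grad :: "complex ^ 'n \<Rightarrow> 'n \<times> 'n \<Rightarrow> complex ^ 'n::finite" where
  "pair_grad z = (\<lambda>(j, k). axis k (z $ k - z $ j) - axis j (z $ k - z $ j))"

lemma inner_pair_grad: "pair_grad z (j, k) \<bullet> d = (z $ k - z $ j) \<bullet> (d $ k - d $ j)"
  by (simp add: pair_grad_def inner_diff_left inner_axis' inner_diff_right)

text \<open>A pair contributes to coordinate \<open>m\<close> only if \<open>m\<close> is its larger
  or its smaller member. The two entries of \<open>pair_grad\<close> are opposite, so both cases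
  yield \<open>z $ m - z $ j\<close>.\<close>

lemma sum_pair_grad_nth:
  fixes z :: "complex ^ 'n::{finite, linorder}"
  shows "(\<Sum>(j, k) \<in> {(j, k). j < k}. c j k *\<^sub>R pair_grad z (j, k)) $ m =
    (\<Sum>j | j < m. c j m *\<^sub>R (z $ m - z $ j)) + (\<Sum>j | j > m. c m j *\<^sub>R (z $ m - z $ j))"
proof -
  let ?P = "{(j, k). j < (k::'n)}"
  have "(\<Sum>(j, k) \<in> ?P. c j k *\<^sub>R pair_grad z (j, k)) $ m =
      (\<Sum>(j, k) \<in> ?P. if k = m then c j k *\<^sub>R (z $ k - z $ j) else 0) +
      (\<Sum>(j, k) \<in> ?P. if j = m then c j k *\<^sub>R (z $ j - z $ k) else 0)"
    unfolding sum_component sum.distrib[symmetric]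
    by (intro sum.cong) (auto simp: pair_grad_def axis_def algebra_simps)
  also have "(\<Sum>(j, k) \<in> ?P. if k = m then c j k *\<^sub>R (z $ k - z $ j) else 0) =
      (\<Sum>(j, k) \<in> (\<lambda>j. (j, m)) ` {j. j < m}. c j k *\<^sub>R (z $ k - z $ j))"
    by (intro sum.mono_neutral_cong_right) auto
  also have "\<dots> = (\<Sum>j | j < m. c j m *\<^sub>R (z $ m - z $ j))"
    by (subst sum.reindex) (auto simp: inj_on_def)
  also have "(\<Sum>(j, k) \<in> ?P. if j = m then c j k *\<^sub>R (z $ j - z $ k) else 0) =
      (\<Sum>(j, k) \<in> Pair m ` {j. j > m}. c j k *\<^sub>R (z $ j - z $ k))"
    by (intro sum.mono_neutral_cong_right) auto
  also have "\<dots> = (\<Sum>j | j > m. c m j *\<^sub>R (z $ m - z $ j))"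
    by (subst sum.reindex) (auto simp: inj_on_def)
  finally show ?thesis .
qed

text \<open>Otherwise, for small positive \<open>t\<close>, moving to
  \<open>z + t *\<^sub>R d\<close> decreases the active constraints to first order and keeps the
  inactive ones negative by continuity. The coordinates stay distinct, so the objective is a
  differentiable sum of logarithms with positive derivative at 0, and it exceeds its value at
  \<open>z\<close>.\<close>

lemma local_maximizer_no_ascent_direction:
  fixes z :: "complex ^ 'n::{finite, linorder}"
  assumes lm: "local_maximizer objective feasible z"
    and asc: "(\<Sum>(j, k) \<in> {(j, k). j < k}. (1 / (cmod (z $ k - z $ j))\<^sup>2) *\<^sub>R pair_grad z (j, k)) \<bullet> d > 0"
  shows "\<exists>(j, k) \<in> {(j, k). j < k \<and> constraint j k z = 0}. pair_grad z (j, k) \<bullet> d \<ge> 0"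
proof (rule ccontr)
  assume "\<not> ?thesis"
  then have desc: "(z $ k - z $ j) \<bullet> (d $ k - d $ j) < 0"
    if "j < k" "constraint j k z = 0" for j k
    using that by (force simp: inner_pair_grad)
  let ?P = "{(j, k). j < (k::'n)}"
  define w where "w t = z + t *\<^sub>R d" for t :: real
  have w_diff: "w t $ k - w t $ j = (z $ k - z $ j) + t *\<^sub>R (d $ k - d $ j)" for t j k
    by (simp add: w_def algebra_simps)
  have lim: "(w \<longlongrightarrow> z) (at_right 0)"
    unfolding w_def by (auto intro!: tendsto_eq_intros)
  have z_inj: "inj (($) z)" using lm by (rule local_maximizer_inj)
  have z_neq: "z $ k - z $ j \<noteq> 0" if "j < k" for j k
    using that injD[OF z_inj, of k j] by auto
  have deriv: "((\<lambda>t. (cmod (w t $ k - w t $ j))\<^sup>2) has_real_derivative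
      2 * ((z $ k - z $ j) \<bullet> (d $ k - d $ j))) (at 0)" for j k
    unfolding w_diff by (rule DERIV_norm_square_line)
  have "\<forall>\<^sub>F t in at_right 0. constraint j k (w t) \<le> 0" if jk: "j < k" for j k
  proof (cases "constraint j k z = 0")
    case True
    from DERIV_neg_dec_right[OF deriv] desc[OF jk True] obtain e where
      e: "e > 0" "\<And>t. 0 < t \<Longrightarrow> t < e \<Longrightarrow> (cmod (w t $ k - w t $ j))\<^sup>2 < (cmod (z $ k - z $ j))\<^sup>2"
      by (force simp: w_def)
    show ?thesis
      using eventually_at_right_real[OF e(1)]
      by eventually_elim (use e(2) True in \<open>force simp: constraint_def\<close>)
  next
    case False
    then have "constraint j k z < 0"
      using lm jk by (auto simp: local_maximizer_def feasible_def less_le)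
    moreover have "((\<lambda>t. constraint j k (w t)) \<longlongrightarrow> constraint j k z) (at_right 0)"
      unfolding constraint_def by (intro tendsto_intros lim)
    ultimately have "\<forall>\<^sub>F t in at_right 0. constraint j k (w t) < 0"
      by (intro order_tendstoD)
    then show ?thesis by (auto elim: eventually_mono)
  qed
  then have "\<forall>\<^sub>F t in at_right 0. w t \<in> feasible"
    unfolding feasible_def mem_Collect_eq
    by (intro eventually_all_finite) (auto simp: eventually_mono)
  from local_maximizer_eventually_le[OF lm lim this]
  have le: "\<forall>\<^sub>F t in at_right 0. objective (w t) \<le> objective z" .
  have w_inj: "\<forall>\<^sub>F t in at_right 0. inj (($) (w t))"
  proof (rule eventually_inj_vec)
    fix j k :: 'n assume "j < k"
    have "((\<lambda>t. w t $ k - w t $ j) \<longlongrightarrow> z $ k - z $ j) (at_right 0)"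
      by (intro tendsto_intros lim)
    then show "\<forall>\<^sub>F t in at_right 0. w t $ k - w t $ j \<noteq> 0"
      using z_neq[OF \<open>j < k\<close>] by (intro tendsto_imp_eventually_ne) auto
  qed
  define F where "F x = (\<Sum>(j, k) \<in> ?P. ln ((cmod (x $ k - x $ j))\<^sup>2))" for x
  \<comment> \<open>The chain rule gives this derivative of \<open>F\<close> along \<open>d\<close>;
    it is twice the inner product in \<open>asc\<close>.\<close>
  let ?D = "\<Sum>(j, k) \<in> ?P. 2 * ((z $ k - z $ j) \<bullet> (d $ k - d $ j)) / (cmod (z $ k - z $ j))\<^sup>2"
  have "((\<lambda>t. ln ((cmod (w t $ k - w t $ j))\<^sup>2)) has_real_derivative
      2 * ((z $ k - z $ j) \<bullet> (d $ k - d $ j)) / (cmod (z $ k - z $ j))\<^sup>2) (at 0)" if "j < k" for j k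
  proof -
    have "0 < (cmod (w 0 $ k - w 0 $ j))\<^sup>2" using z_neq[OF that] by (simp add: w_def)
    from DERIV_chain2[OF DERIV_ln_divide[OF this] deriv] show ?thesis by (simp add: w_def)
  qed
  then have F_deriv: "((\<lambda>t. F (w t)) has_real_derivative ?D) (at 0)"
    unfolding F_def by (auto intro!: DERIV_sum simp: case_prod_unfold)
  have "?D = 2 * ((\<Sum>(j, k) \<in> ?P. (1 / (cmod (z $ k - z $ j))\<^sup>2) *\<^sub>R pair_grad z (j, k)) \<bullet> d)"
    unfolding inner_sum_left sum_distrib_left
    by (intro sum.cong) (auto simp: inner_pair_grad)
  then have "?D > 0" using asc by simp
  from DERIV_pos_inc_right[OF F_deriv this] obtain e where
    e: "e > 0" "\<And>t. 0 < t \<Longrightarrow> t < e \<Longrightarrow> F z < F (w t)"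
    by (force simp: w_def)
  have "\<forall>\<^sub>F t in at_right (0::real). False"
    using le w_inj eventually_at_right_real[OF e(1)]
    by eventually_elim (use e(2) in \<open>force simp: objective_inj z_inj F_def\<close>)
  then show False by simp
qed

section \<open>From Fritz John weights to the multipliers\<close>

theorem theorem2p8:
  fixes z :: "complex ^ 'n::{finite, linorder}"
  assumes "local_maximizer objective feasible z"
  shows "\<exists>lam :: 'n \<Rightarrow> 'n \<Rightarrow> real.
    (\<forall>j k. j < k \<longrightarrow> lam j k \<ge> 0) \<and>
    (\<forall>j k. j < k \<longrightarrow> lam j k * constraint j k z = 0) \<and>
    (\<forall>k. (\<Sum>j | j \<noteq> k. 1 / (z $ j - z $ k)) =
      (\<Sum>j | j < k. complex_of_real (lam j k) * (cnj (z $ j) - cnj (z $ k))) +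
      (\<Sum>j | j > k. complex_of_real (lam k j) * (cnj (z $ j) - cnj (z $ k))))"
proof -
  let ?P = "{(j, k). j < (k::'n)}"
  let ?A = "{(j, k). j < k \<and> constraint j k z = 0}"
  define c where "c j k = 1 / (cmod (z $ k - z $ j))\<^sup>2" for j k
  define G where "G = (\<Sum>(j, k) \<in> ?P. c j k *\<^sub>R pair_grad z (j, k))"
  have dir: "\<exists>p\<in>?A. pair_grad z p \<bullet> d \<ge> 0" if "G \<bullet> d > 0" for d
    using local_maximizer_no_ascent_direction[OF assms, of d] that
    unfolding G_def c_def by blast
  obtain \<mu> u where
    \<mu>: "\<mu> \<ge> (0::real)" and u: "\<forall>p\<in>?A. u p \<ge> (0::real)" and \<mu>u: "\<mu> + sum u ?A = 1"
    and eq: "\<mu> *\<^sub>R G = (\<Sum>p\<in>?A. u p *\<^sub>R pair_grad z p)"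
    by (rule Fritz_John_alternative[OF finite dir])
  have "\<mu> \<noteq> 0"
  proof
    assume "\<mu> = 0"
    have "0 = (\<Sum>p\<in>?A. u p *\<^sub>R pair_grad z p) \<bullet> z" using eq \<open>\<mu> = 0\<close> by simp
    \<comment> \<open>The inner product of \<open>pair_grad z p\<close> with \<open>z\<close> is the
      squared distance of the pair, which is 4 on active constraints.\<close>
    also have "\<dots> = (\<Sum>p\<in>?A. u p * 4)"
      unfolding inner_sum_left
      by (intro sum.cong)
        (auto simp: inner_pair_grad constraint_def power2_norm_eq_inner)
    also have "\<dots> = 4" using \<mu>u \<open>\<mu> = 0\<close> by (simp add: sum_distrib_right[symmetric])
    finally show False by simp
  qed
  \<comment> \<open>Dividing by \<open>\<mu>\<close> normalizes the weight of \<open>G\<close> to 1;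
    the value 0 off \<open>?A\<close> gives complementary slackness.\<close>
  define lam where "lam j k = (if (j, k) \<in> ?A then u (j, k) / \<mu> else 0)" for j k
  have "G = (1 / \<mu>) *\<^sub>R (\<Sum>p\<in>?A. u p *\<^sub>R pair_grad z p)"
    using \<open>\<mu> \<noteq> 0\<close> by (simp flip: eq)
  also have "\<dots> = (\<Sum>(j, k) \<in> ?P. lam j k *\<^sub>R pair_grad z (j, k))"
    unfolding scaleR_sum_right
    by (intro sum.mono_neutral_cong_left) (auto simp: lam_def split: if_splits)
  finally have G_lam: "G = (\<Sum>(j, k) \<in> ?P. lam j k *\<^sub>R pair_grad z (j, k))" .
  \<comment> \<open>This is 1/w = cnj w / |w|^2, in both index orders since \<open>c\<close> is
    symmetric. For equal entries both sides are 0, by the convention for division by 0.\<close>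
  have c_cnj: "complex_of_real (c j k) * (cnj (z $ j) - cnj (z $ k)) = 1 / (z $ j - z $ k)"
    "complex_of_real (c k j) * (cnj (z $ j) - cnj (z $ k)) = 1 / (z $ j - z $ k)" for j k
    using complex_div_cnj[of 1 "z $ j - z $ k"] by (simp_all add: c_def norm_minus_commute)
  \<comment> \<open>Conjugating and negating brings the coordinates of a gradient sum into the form
    of the claim. With weights \<open>c\<close> this gives its left side, with \<open>lam\<close>
    its right side.\<close>
  have cnj_nth: "- cnj ((\<Sum>(j, k) \<in> ?P. b j k *\<^sub>R pair_grad z (j, k)) $ m) =
      (\<Sum>j | j < m. complex_of_real (b j m) * (cnj (z $ j) - cnj (z $ m))) +
      (\<Sum>j | j > m. complex_of_real (b m j) * (cnj (z $ j) - cnj (z $ m)))" for b m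
    unfolding sum_pair_grad_nth
    by (simp add: scaleR_conv_of_real right_diff_distrib sum_subtractf)
  have "(\<Sum>j | j \<noteq> k. 1 / (z $ j - z $ k)) =
      (\<Sum>j | j < k. complex_of_real (lam j k) * (cnj (z $ j) - cnj (z $ k))) +
      (\<Sum>j | j > k. complex_of_real (lam k j) * (cnj (z $ j) - cnj (z $ k)))" for k
  proof -
    have split: "{j. j \<noteq> k} = {j. j < k} \<union> {j. j > k}" by auto
    have "(\<Sum>j | j \<noteq> k. 1 / (z $ j - z $ k)) =
        (\<Sum>j | j < k. 1 / (z $ j - z $ k)) + (\<Sum>j | j > k. 1 / (z $ j - z $ k))"
      unfolding split by (rule sum.union_disjoint) auto
    also have "\<dots> = - cnj (G $ k)"
      unfolding G_def cnj_nth by (simp only: c_cnj)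
    also have "\<dots> = (\<Sum>j | j < k. complex_of_real (lam j k) * (cnj (z $ j) - cnj (z $ k))) +
        (\<Sum>j | j > k. complex_of_real (lam k j) * (cnj (z $ j) - cnj (z $ k)))"
      unfolding G_lam cnj_nth ..
    finally show ?thesis .
  qed
  moreover have "lam j k \<ge> 0" "lam j k * constraint j k z = 0" for j k
    using \<mu> u by (auto simp: lam_def)
  ultimately show ?thesis by blast
qed

end
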